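(* Let $\mathcal{U}=\begin{bmatrix}\mathcal{A}&\mathcal{M}\\ \mathcal{N}&\mathcal{B}\end{bmatrix}$ be a unital generalized matrix algebra satisfying the following conditions: $$a\in\mathcal{A},\ a\mathcal{M}=0\ \text{ and }\ \mathcal{N}a=0\ \Rightarrow\ a=0,$$ $$b\in\mathcal{B},\ \mathcal{M}b=0\ \text{ and }\ b\mathcal{N}=0\ \Rightarrow\ b=0.$$ Suppose that $\phi:\mathcal{U}\to\mathcal{U}$ is a linear Lie triple centralizer, and let $\alpha_4:\mathcal{A}\to\mathcal{B}$ and $\beta_1:\mathcal{B}\to\mathcal{A}$ be the maps determined by $$\phi\left(\begin{bmatrix}a&0\\0&0\end{bmatrix}\right)=\begin{bmatrix}\ast&\ast\\ \ast&\alpha_4(a)\end{bmatrix},\qquad \phi\left(\begin{bmatrix}0&0\\0&b\end{bmatrix}\right)=\begin{bmatrix}\beta_1(b)&\ast\\ \ast&\ast\end{bmatrix}$$ for all $a\in\mathcal{A}$ and $b\in\mathcal{B}$ (where $\ast$ denotes unspecified entries). Then the following statements are equivalent: (i) $\phi$ is a proper Lie triple centralizer on $\mathcal{U}$; (ii) $\alpha_4(\mathcal{A})\subseteq\pi_{\mathcal{B}}(Z(\mathcal{U}))$ and $\beta_1(\mathcal{B})\subseteq\pi_{\mathcal{A}}(Z(\mathcal{U}))$; (iii) $\alpha_4(1_{\mathcal{A}})\in\pi_{\mathcal{B}}(Z(\mathcal{U}))$ and $\beta_1(1_{\mathcal{B}})\in\pi_{\mathcal{A}}(Z(\mathcal{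U}))$.
   Context: All algebras (associative) and modules are over a unital commutative ring $\mathcal{R}$, and linear means $\mathcal{R}$-linear. $[x,y]=xy-yx$, and $Z(\mathcal{G})$ is the center of an algebra $\mathcal{G}$. A Morita context consists of algebras $\mathcal{A},\mathcal{B}$, an $(\mathcal{A},\mathcal{B})$-bimodule $\mathcal{M}$, a $(\mathcal{B},\mathcal{A})$-bimodule $\mathcal{N}$, and bimodule homomorphisms $\mathcal{M}\otimes_{\mathcal{B}}\mathcal{N}\to\mathcal{A}$, $m\otimes n\mapsto mn$, and $\mathcal{N}\otimes_{\mathcal{A}}\mathcal{M}\to\mathcal{B}$, $n\otimes m\mapsto nm$, satisfying $(mn)m'=m(nm')$ and $(nm)n'=n(mn')$ for all $m,m'\in\mathcal{M}$, $n,n'\in\mathcal{N}$. The set $\mathcal{U}=\begin{bmatrix}\mathcal{A}&\mathcal{M}\\ \mathcal{N}&\mathcal{B}\end{bmatrix}$ of all matrices $\begin{bmatrix}a&m\\ n&b\end{bmatrix}$ ($a\in\mathcal{A}$, $m\in\mathcal{M}$, $n\in\mathcal{N}$, $b\in\mathcal{B}$), with the usual matrix operations, is an algebra called a generalized matrix algebra. It is unital exactly when $\mathcal{A},\mathcal{B}$ are unital with identities $1_{\mathcal{A}},1_{\mathcal{B}}$ and $\mathcal{M},\mathcal{N}$ are unital bimodules ($1_{\mathcal{A}}m=m=m1_{\mathcal{B}}$, $1_{\mathcal{B}}n=n=n1_{\mathcal{A}}$). The projections $\pi_{\mathcal{A}}:\mathcal{U}\to\mathcal{A}$ and $\pi_{\mathcal{B}}:\mathcal{U}\to\mathcal{B}$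 send $\begin{bmatrix}a&m\\ n&b\end{bmatrix}$ to $a$ and $b$, respectively. A linear map $\phi:\mathcal{G}\to\mathcal{G}$ on an algebra $\mathcal{G}$ is a Lie triple centralizer if $\phi([[a,b],c])=[[\phi(a),b],c]$ for all $a,b,c\in\mathcal{G}$. It is a proper Lie triple centralizer if there are $\lambda\in Z(\mathcal{G})$ and a linear map $\chi:\mathcal{G}\to Z(\mathcal{G})$ with $\chi([[a,b],c])=0$ for all $a,b,c\in\mathcal{G}$ such that $\phi(a)=\lambda a+\chi(a)$ for all $a\in\mathcal{G}$. *)

theory Defs
  imports Complex_Main "HOL-Library.Product_Plus"
begin

(* Addition lives in type classes; scalar actions and products are explicit parameters, because
   the product of a generalized matrix algebra depends on the Morita context.  Algebras are
   not assumed unital: an identity element, when there is one, is an explicit parameter (rather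
   than the class constant 1), so that the zero algebra is allowed. *)

definition bilinear_map ::
  "('r::comm_ring_1 \<Rightarrow> 'x::ab_group_add \<Rightarrow> 'x) \<Rightarrow> ('r \<Rightarrow> 'y::ab_group_add \<Rightarrow> 'y) \<Rightarrow>
   ('r \<Rightarrow> 'z::ab_group_add \<Rightarrow> 'z) \<Rightarrow> ('x \<Rightarrow> 'y \<Rightarrow> 'z) \<Rightarrow> bool" where
  "bilinear_map s1 s2 s3 f \<longleftrightarrow>
     (\<forall>y. module_hom s1 s3 (\<lambda>x. f x y)) \<and> (\<forall>x. module_hom s2 s3 (\<lambda>y. f x y))"

definition assoc_algebra ::
  "('r::comm_ring_1 \<Rightarrow> 'g::ab_group_add \<Rightarrow> 'g) \<Rightarrow> ('g \<Rightarrow> 'g \<Rightarrow> 'g) \<Rightarrow> bool" where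
  "assoc_algebra s mul \<longleftrightarrow>
     bilinear_map s s s mul \<and> (\<forall>x y z. mul (mul x y) z = mul x (mul y z))"

definition identity_element :: "('g \<Rightarrow> 'g \<Rightarrow> 'g) \<Rightarrow> 'g \<Rightarrow> bool" where
  "identity_element mul e \<longleftrightarrow> (\<forall>x. mul e x = x \<and> mul x e = x)"

definition alg_center :: "('g \<Rightarrow> 'g \<Rightarrow> 'g) \<Rightarrow> 'g set" where
  "alg_center mul = {z. \<forall>x. mul z x = mul x z}"

definition commutator :: "('g::ab_group_add \<Rightarrow> 'g \<Rightarrow> 'g) \<Rightarrow> 'g \<Rightarrow> 'g \<Rightarrow> 'g" where
  "commutator mul x y = mul x y - mul y x"

definition lie_triple_centralizer ::
  "('r::comm_ring_1 \<Rightarrow> 'g::ab_group_add \<Rightarrow> 'g) \<Rightarrow> ('g \<Rightarrow> 'g \<Rightarrow> 'g) \<Rightarrow> ('g \<Rightarrow> 'g) \<Rightarrow> bool" where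
  "lie_triple_centralizer s mul \<phi> \<longleftrightarrow>
     module_hom s s \<phi> \<and>
     (\<forall>a b c. \<phi> (commutator mul (commutator mul a b) c) =
              commutator mul (commutator mul (\<phi> a) b) c)"

definition proper_lie_triple_centralizer ::
  "('r::comm_ring_1 \<Rightarrow> 'g::ab_group_add \<Rightarrow> 'g) \<Rightarrow> ('g \<Rightarrow> 'g \<Rightarrow> 'g) \<Rightarrow> ('g \<Rightarrow> 'g) \<Rightarrow> bool" where
  "proper_lie_triple_centralizer s mul \<phi> \<longleftrightarrow>
     lie_triple_centralizer s mul \<phi> \<and>
     (\<exists>l \<chi>. l \<in> alg_center mul \<and>
        module_hom s s \<chi> \<and> range \<chi> \<subseteq> alg_center mul \<and>
        (\<forall>a b c. \<chi> (commutator mul (commutator mul a b) c) = 0) \<and>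
        (\<forall>a. \<phi> a = mul l a + \<chi> a))"

(* lact is the left action of 'a on 'm, ract the right action of 'b on 'm. *)
locale bimodule =
  fixes sA :: "'r::comm_ring_1 \<Rightarrow> 'a::ring \<Rightarrow> 'a"
    and sB :: "'r \<Rightarrow> 'b::ring \<Rightarrow> 'b"
    and sM :: "'r \<Rightarrow> 'm::ab_group_add \<Rightarrow> 'm"
    and lact :: "'a \<Rightarrow> 'm \<Rightarrow> 'm"
    and ract :: "'m \<Rightarrow> 'b \<Rightarrow> 'm"
  assumes lact_bilinear: "bilinear_map sA sM sM lact"
    and ract_bilinear: "bilinear_map sM sB sM ract"
    and lact_assoc: "lact (a * a') x = lact a (lact a' x)"
    and ract_assoc: "ract x (b * b') = ract (ract x b) b'"
    and lact_ract: "ract (lact a x) b = lact a (ract x b)"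

(* A homomorphism on the tensor product of a bimodule M with a bimodule N over B is given,
   through the universal property, by a bilinear B-balanced map on pairs. *)
locale balanced_pairing =
  fixes sA :: "'r::comm_ring_1 \<Rightarrow> 'a::ring \<Rightarrow> 'a"
    and sM :: "'r \<Rightarrow> 'm::ab_group_add \<Rightarrow> 'm"
    and sN :: "'r \<Rightarrow> 'n::ab_group_add \<Rightarrow> 'n"
    and am :: "'a \<Rightarrow> 'm \<Rightarrow> 'm" and mb :: "'m \<Rightarrow> 'b::ring \<Rightarrow> 'm"
    and bn :: "'b \<Rightarrow> 'n \<Rightarrow> 'n" and na :: "'n \<Rightarrow> 'a \<Rightarrow> 'n"
    and mn :: "'m \<Rightarrow> 'n \<Rightarrow> 'a"
  assumes pairing_bilinear: "bilinear_map sM sN sA mn"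
    and pairing_balanced: "mn (mb m b) n = mn m (bn b n)"
    and pairing_left: "mn (am a m) n = a * mn m n"
    and pairing_right: "mn m (na n a) = mn m n * a"

locale morita_context =
  fixes sA :: "'r::comm_ring_1 \<Rightarrow> 'a::ring \<Rightarrow> 'a"
    and sB :: "'r \<Rightarrow> 'b::ring \<Rightarrow> 'b"
    and sM :: "'r \<Rightarrow> 'm::ab_group_add \<Rightarrow> 'm"
    and sN :: "'r \<Rightarrow> 'n::ab_group_add \<Rightarrow> 'n"
    and am :: "'a \<Rightarrow> 'm \<Rightarrow> 'm" and mb :: "'m \<Rightarrow> 'b \<Rightarrow> 'm"
    and bn :: "'b \<Rightarrow> 'n \<Rightarrow> 'n" and na :: "'n \<Rightarrow> 'a \<Rightarrow> 'n"
    and mn :: "'m \<Rightarrow> 'n \<Rightarrow> 'a" and nm :: "'n \<Rightarrow> 'm \<Rightarrow> 'b"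
  assumes algebra_A: "assoc_algebra sA (*)"
    and algebra_B: "assoc_algebra sB (*)"
    and bimodule_M: "bimodule sA sB sM am mb"
    and bimodule_N: "bimodule sB sA sN bn na"
    and pairing_mn: "balanced_pairing sA sM sN am mb bn na mn"
    and pairing_nm: "balanced_pairing sB sN sM bn na am mb nm"
    and mn_nm: "am (mn m n) m' = mb m (nm n m')"
    and nm_mn: "bn (nm n m) n' = na n (mn m n')"

locale unital_morita_context =
  morita_context sA sB sM sN am mb bn na mn nm
  for sA :: "'r::comm_ring_1 \<Rightarrow> 'a::ring \<Rightarrow> 'a"
    and sB :: "'r \<Rightarrow> 'b::ring \<Rightarrow> 'b"
    and sM :: "'r \<Rightarrow> 'm::ab_group_add \<Rightarrow> 'm"
    and sN :: "'r \<Rightarrow> 'n::ab_group_add \<Rightarrow> 'n"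
    and am mb bn na mn nm +
  fixes oneA :: 'a and oneB :: 'b
  assumes identity_A: "identity_element (*) oneA"
    and identity_B: "identity_element (*) oneB"
    and unital_M: "am oneA m = m" "mb m oneB = m"
    and unital_N: "bn oneB n = n" "na n oneA = n"

(* The matrix with rows (a, m) and (n, b) is the tuple (a, m, n, b). *)
type_synonym ('a, 'm, 'n, 'b) gmat = "'a \<times> 'm \<times> 'n \<times> 'b"

definition gma_scale ::
  "('r \<Rightarrow> 'a \<Rightarrow> 'a) \<Rightarrow> ('r \<Rightarrow> 'b \<Rightarrow> 'b) \<Rightarrow> ('r \<Rightarrow> 'm \<Rightarrow> 'm) \<Rightarrow> ('r \<Rightarrow> 'n \<Rightarrow> 'n) \<Rightarrow>
   'r \<Rightarrow> ('a, 'm, 'n, 'b) gmat \<Rightarrow> ('a, 'm, 'n, 'b) gmat" where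
  "gma_scale sA sB sM sN r = (\<lambda>(a, m, n, b). (sA r a, sM r m, sN r n, sB r b))"

definition gma_mult ::
  "('a::ring \<Rightarrow> 'm::ab_group_add \<Rightarrow> 'm) \<Rightarrow> ('m \<Rightarrow> 'b::ring \<Rightarrow> 'm) \<Rightarrow>
   ('b \<Rightarrow> 'n::ab_group_add \<Rightarrow> 'n) \<Rightarrow> ('n \<Rightarrow> 'a \<Rightarrow> 'n) \<Rightarrow>
   ('m \<Rightarrow> 'n \<Rightarrow> 'a) \<Rightarrow> ('n \<Rightarrow> 'm \<Rightarrow> 'b) \<Rightarrow>
   ('a, 'm, 'n, 'b) gmat \<Rightarrow> ('a, 'm, 'n, 'b) gmat \<Rightarrow> ('a, 'm, 'n, 'b) gmat" where
  "gma_mult am mb bn na mn nm = (\<lambda>(a, m, n, b) (a', m', n', b').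
     (a * a' + mn m n', am a m' + mb m b',
      na n a' + bn b n', nm n m' + b * b'))"

definition proj_A :: "('a, 'm, 'n, 'b) gmat \<Rightarrow> 'a" where
  "proj_A = (\<lambda>(a, m, n, b). a)"

definition proj_B :: "('a, 'm, 'n, 'b) gmat \<Rightarrow> 'b" where
  "proj_B = (\<lambda>(a, m, n, b). b)"

lemma bilinear_mapD:
  assumes "bilinear_map s1 s2 s3 f"
  shows "module s1" "module s2" "module s3"
    "f (x + x') y = f x y + f x' y" "f x (y + y') = f x y + f x y'"
    "f (s1 r x) y = s3 r (f x y)" "f x (s2 r y) = s3 r (f x y)"
    "f 0 y = 0" "f x 0 = 0"
proof -
  have 1: "module_hom s1 s3 (\<lambda>x. f x y)" and 2: "module_hom s2 s3 (f x)" for x y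
    using assms by (auto simp: bilinear_map_def)
  show "module s1" "module s2" "module s3"
    using 1 2 by (auto simp: module_hom_def)
  show "f (x + x') y = f x y + f x' y" "f (s1 r x) y = s3 r (f x y)" "f 0 y = 0"
    using module_hom.add[OF 1] module_hom.scale[OF 1] module_hom.zero[OF 1] by auto
  show "f x (y + y') = f x y + f x y'" "f x (s2 r y) = s3 r (f x y)" "f x 0 = 0"
    using module_hom.add[OF 2] module_hom.scale[OF 2] module_hom.zero[OF 2] by auto
qed

context morita_context
begin

interpretation M: bimodule sA sB sM am mb by (rule bimodule_M)
interpretation N: bimodule sB sA sN bn na by (rule bimodule_N)
interpretation MN: balanced_pairing sA sM sN am mb bn na mn by (rule pairing_mn)
interpretation NM: balanced_pairing sB sN sM bn na am mb nm by (rule pairing_nm)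

lemma bilinear_A: "bilinear_map sA sA sA (*)"
  and bilinear_B: "bilinear_map sB sB sB (*)"
  using algebra_A algebra_B by (auto simp: assoc_algebra_def)

lemmas modules =
  bilinear_mapD(1)[OF bilinear_A] bilinear_mapD(1)[OF bilinear_B]
  bilinear_mapD(2)[OF M.lact_bilinear] bilinear_mapD(2)[OF N.lact_bilinear]

lemmas gma_bilinear =
  bilinear_mapD(4-9)[OF bilinear_A] bilinear_mapD(4-9)[OF bilinear_B]
  bilinear_mapD(4-9)[OF M.lact_bilinear] bilinear_mapD(4-9)[OF M.ract_bilinear]
  bilinear_mapD(4-9)[OF N.lact_bilinear] bilinear_mapD(4-9)[OF N.ract_bilinear]
  bilinear_mapD(4-9)[OF MN.pairing_bilinear] bilinear_mapD(4-9)[OF NM.pairing_bilinear]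

lemmas gma_assoc =
  M.lact_assoc M.ract_assoc M.lact_ract N.lact_assoc N.ract_assoc N.lact_ract
  MN.pairing_balanced MN.pairing_left MN.pairing_right
  NM.pairing_balanced NM.pairing_left NM.pairing_right mn_nm nm_mn

lemma gma_module: "module (gma_scale sA sB sM sN)"
  using modules unfolding module_def gma_scale_def by (auto simp: plus_prod_def)

lemma gma_assoc_algebra:
  "assoc_algebra (gma_scale sA sB sM sN) (gma_mult am mb bn na mn nm)"
proof -
  have dist: "s r (x + y) = s r x + s r y" if "module s" for s :: "'r \<Rightarrow> 'x::ab_group_add \<Rightarrow> 'x" and r x y
    using that by (simp add: module_def)
  note dists = modules[THEN dist]
  show ?thesis
    unfolding assoc_algebra_def bilinear_map_def module_hom_def module_hom_axioms_def
    using gma_module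
    by (auto simp: gma_mult_def gma_scale_def gma_bilinear gma_assoc dists mult.assoc algebra_simps)
qed

lemma gma_identity_iff:
  "identity_element (gma_mult am mb bn na mn nm) (e, m0, n0, f) \<longleftrightarrow>
     m0 = 0 \<and> n0 = 0 \<and> unital_morita_context sA sB sM sN am mb bn na mn nm e f"
  (is "?L \<longleftrightarrow> ?R")
proof
  assume L: ?L
  have *: "gma_mult am mb bn na mn nm (e, m0, n0, f) x = x"
    "gma_mult am mb bn na mn nm x (e, m0, n0, f) = x" for x
    using L unfolding identity_element_def by blast+
  have a: "e * a = a" "a * e = a" "na n0 a = 0" "am a m0 = 0" for a
    using *[of "(a, 0, 0, 0)"] by (auto simp: gma_mult_def gma_bilinear)
  have b: "f * b = b" "b * f = b" "mb m0 b = 0" "bn b n0 = 0" for b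
    using *[of "(0, 0, 0, b)"] by (auto simp: gma_mult_def gma_bilinear)
  have m: "am e m = m" "mb m f = m" for m
    using *[of "(0, m, 0, 0)"] by (auto simp: gma_mult_def gma_bilinear)
  have n: "bn f n = n" "na n e = n" for n
    using *[of "(0, 0, n, 0)"] by (auto simp: gma_mult_def gma_bilinear)
  have "m0 = 0" "n0 = 0" using a(4)[of e] m(1)[of m0] a(3)[of e] n(2)[of n0] by auto
  moreover have "unital_morita_context sA sB sM sN am mb bn na mn nm e f"
    by unfold_locales (auto simp: identity_element_def a b m n)
  ultimately show ?R by blast
next
  assume ?R
  then interpret unital_morita_context sA sB sM sN am mb bn na mn nm e f by blast
  show ?L using \<open>?R\<close> identity_A identity_B unital_M unital_N
    by (auto simp: identity_element_def gma_mult_def gma_bilinear)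
qed

end

end

theory Submission
  imports Defs
begin

text \<open>
  Write \<open>e = (oneA, 0, 0, 0)\<close> and \<open>f = (0, 0, 0, oneB)\<close>.  The operation \<open>x \<mapsto> [[x, y], f]\<close> with
  \<open>y\<close> off-diagonal is a test for centrality: it records how far the diagonal entries of \<open>x\<close> are
  from intertwining the actions on the two bimodules, and under the faithfulness conditions the
  center consists exactly of the diagonal matrices whose entries do intertwine them
  (\<open>center_iff\<close>).  With \<open>y = e\<close> the same operation returns the off-diagonal part of \<open>x\<close>.

  An off-diagonal \<open>y\<close> satisfies both \<open>y = [[e, y], f]\<close> and \<open>y = - [[f, y], f]\<close>.  Hence a Lie
  triple centralizer \<open>\<phi>\<close> is determined on off-diagonal matrices in two ways, by the diagonal entries
  \<open>P, Q\<close> of \<open>\<phi> e\<close> and by the diagonal entries \<open>R, S\<close> of \<open>\<phi> f\<close>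
  (\<open>centralizer_offdiag_e\<close>, \<open>centralizer_offdiag_f\<close>).  The entries \<open>Q\<close> and \<open>R\<close> are the values of
  \<open>\<alpha>\<^sub>4\<close> and \<open>\<beta>\<^sub>1\<close> at the identities.  If both are entries of central matrices, say \<open>(a\<^sub>0, Q)\<close> and
  \<open>(R, b\<^sub>0)\<close>, the first formula says that \<open>\<phi>\<close> acts on off-diagonal matrices through \<open>P - a\<^sub>0\<close> on the
  \<open>A\<close> side, and the second that it acts through \<open>S - b\<^sub>0\<close> on the \<open>B\<close> side.  So these two entries
  intertwine, \<open>\<lambda> = (P - a\<^sub>0, S - b\<^sub>0)\<close> is central, and \<open>\<phi>\<close> is multiplication by \<open>\<lambda>\<close> off the diagonal.

  Then \<open>\<chi> = \<phi> - \<lambda> \<cdot>\<close> is a Lie triple centralizer that kills off-diagonal matrices.  Every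
  \<open>[[x, y], f]\<close> with \<open>y\<close> off-diagonal or \<open>y = e\<close> is off-diagonal, so
  \<open>[[\<chi> x, y], f] = \<chi> [[x, y], f] = 0\<close>, and the test shows that \<open>\<chi>\<close> has central values
  (\<open>centralizer_offdiag_zero_central\<close>).  Consequently \<open>\<chi> [[x, y], z] = [[\<chi> x, y], z] = 0\<close>, and \<open>\<phi>\<close>
  is proper.  Conversely, if \<open>\<phi> = \<lambda> \<cdot> + \<chi>\<close> is proper, then \<open>\<lambda>\<close> is diagonal, so the entries
  \<open>\<alpha>\<^sub>4 a\<close> and \<open>\<beta>\<^sub>1 b\<close> come from \<open>\<chi>\<close> alone.
\<close>

section \<open>Lie triple centralizers of an associative algebra\<close>

lemma bilinear_map_diff:
  assumes "bilinear_map s1 s2 s3 f"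
  shows "f (x - x') y = f x y - f x' y" "f x (y - y') = f x y - f x y'"
  using assms module_hom.diff[of s1 s3 "\<lambda>x. f x y"] module_hom.diff[of s2 s3 "f x"]
  by (simp_all add: bilinear_map_def)

lemma assoc_algebra_bilinear:
  assumes "assoc_algebra s mul"
  shows "bilinear_map s s s mul"
  using assms by (simp add: assoc_algebra_def)

lemma alg_center_commute:
  assumes "z \<in> alg_center mul"
  shows "mul z x = mul x z"
  using assms by (simp add: alg_center_def)

lemma lie_triple_centralizer_commutator:
  assumes "lie_triple_centralizer s mul \<phi>"
  shows "\<phi> (commutator mul (commutator mul x y) z) = commutator mul (commutator mul (\<phi> x) y) z"
  using assms by (simp add: lie_triple_centralizer_def)

lemma lie_triple_centralizer_uminus:
  assumes "lie_triple_centralizer s mul \<phi>"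
  shows "\<phi> (- x) = - \<phi> x"
proof -
  have "module_hom s s \<phi>"
    using assms by (simp add: lie_triple_centralizer_def)
  then show ?thesis by (rule module_hom.neg)
qed

lemma proper_lie_triple_centralizerE:
  assumes "proper_lie_triple_centralizer s mul \<phi>"
  obtains l \<chi> where "l \<in> alg_center mul" "\<And>x. \<chi> x \<in> alg_center mul"
    "\<And>x. \<phi> x = mul l x + \<chi> x"
  using assms unfolding proper_lie_triple_centralizer_def
proof (elim conjE exE)
  fix l \<chi>
  assume "l \<in> alg_center mul" "range \<chi> \<subseteq> alg_center mul" "\<forall>x. \<phi> x = mul l x + \<chi> x"
  then show thesis by (intro that[of l \<chi>]) auto
qed

lemma commutator_central:
  assumes "z \<in> alg_center mul"
  shows "commutator mul z x = 0"
  using assms by (simp add: alg_center_def commutator_def)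

lemma commutator_zero:
  assumes "assoc_algebra s mul"
  shows "commutator mul 0 x = 0"
  by (simp add: commutator_def bilinear_mapD(8,9)[OF assoc_algebra_bilinear[OF assms]])

lemma commutator_diff_left:
  assumes "assoc_algebra s mul"
  shows "commutator mul (x - x') y = commutator mul x y - commutator mul x' y"
  by (simp add: commutator_def bilinear_map_diff[OF assoc_algebra_bilinear[OF assms]])

lemma commutator_central_mult:
  assumes alg: "assoc_algebra s mul" and l: "l \<in> alg_center mul"
  shows "commutator mul (mul l x) y = mul l (commutator mul x y)"
proof -
  have assoc: "mul (mul u v) w = mul u (mul v w)" for u v w
    using alg by (simp add: assoc_algebra_def)
  have "mul y (mul l x) = mul l (mul y x)"
    using alg_center_commute[OF l] by (metis assoc)
  moreover have "mul l (u - v) = mul l u - mul l v" for u v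
    by (rule bilinear_map_diff(2)[OF assoc_algebra_bilinear[OF alg]])
  ultimately show ?thesis
    by (simp add: commutator_def assoc)
qed

lemma lie_triple_centralizer_diff_central_mult:
  assumes alg: "assoc_algebra s mul" and l: "l \<in> alg_center mul"
    and \<phi>: "lie_triple_centralizer s mul \<phi>"
  shows "lie_triple_centralizer s mul (\<lambda>x. \<phi> x - mul l x)"
proof -
  have "module_hom s s \<phi>" "module_hom s s (mul l)"
    using alg \<phi> by (auto simp: assoc_algebra_def bilinear_map_def lie_triple_centralizer_def)
  then have "module_hom s s (\<lambda>x. \<phi> x - mul l x)"
    by (intro module_pair.module_hom_sub) (auto simp: module_hom_def module_pair_def)
  then show ?thesis
    by (simp add: lie_triple_centralizer_def commutator_diff_left[OF alg]
        commutator_central_mult[OF alg l] lie_triple_centralizer_commutator[OF \<phi>])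
qed

text \<open>
  For a Lie triple centralizer, central values of \<open>\<chi>\<close> force \<open>\<chi> [[x, y], z] = [[\<chi> x, y], z] = 0\<close>, so
  properness only asks for a central \<open>l\<close> that makes \<open>\<phi> - l \<cdot>\<close> central-valued.
\<close>

lemma proper_lie_triple_centralizerI:
  assumes alg: "assoc_algebra s mul" and l: "l \<in> alg_center mul"
    and \<phi>: "lie_triple_centralizer s mul \<phi>"
    and central: "\<And>x. \<phi> x - mul l x \<in> alg_center mul"
  shows "proper_lie_triple_centralizer s mul \<phi>"
proof -
  define \<chi> where "\<chi> = (\<lambda>x. \<phi> x - mul l x)"
  have \<chi>: "lie_triple_centralizer s mul \<chi>"
    unfolding \<chi>_def by (rule lie_triple_centralizer_diff_central_mult[OF alg l \<phi>])
  have central': "\<chi> x \<in> alg_center mul" for x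
    using central by (simp add: \<chi>_def)
  have "\<chi> (commutator mul (commutator mul x y) z) = 0" for x y z
    by (simp add: lie_triple_centralizer_commutator[OF \<chi>] commutator_central[OF central']
        commutator_zero[OF alg])
  moreover have "\<phi> x = mul l x + \<chi> x" for x
    by (simp add: \<chi>_def)
  ultimately show ?thesis
    using \<phi> \<chi> l central' unfolding proper_lie_triple_centralizer_def lie_triple_centralizer_def
    by blast
qed

section \<open>The center of a faithful generalized matrix algebra\<close>

locale faithful_morita_context =
  unital_morita_context sA sB sM sN am mb bn na mn nm oneA oneB
  for sA :: "'r::comm_ring_1 \<Rightarrow> 'a::ring \<Rightarrow> 'a"
    and sB :: "'r \<Rightarrow> 'b::ring \<Rightarrow> 'b"
    and sM :: "'r \<Rightarrow> 'm::ab_group_add \<Rightarrow> 'm"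
    and sN :: "'r \<Rightarrow> 'n::ab_group_add \<Rightarrow> 'n"
    and am mb bn na mn nm oneA oneB +
  assumes faithful_A: "(\<And>m. am a m = 0) \<Longrightarrow> (\<And>n. na n a = 0) \<Longrightarrow> a = 0"
    and faithful_B: "(\<And>m. mb m b = 0) \<Longrightarrow> (\<And>n. bn b n = 0) \<Longrightarrow> b = 0"
begin

abbreviation "sU \<equiv> gma_scale sA sB sM sN"
abbreviation "mulU \<equiv> gma_mult am mb bn na mn nm"
abbreviation "brU \<equiv> commutator mulU"
abbreviation eU :: "('a, 'm, 'n, 'b) gmat" where "eU \<equiv> (oneA, 0, 0, 0)"
abbreviation fU :: "('a, 'm, 'n, 'b) gmat" where "fU \<equiv> (0, 0, 0, oneB)"

lemma one_simps [simp]: "oneA * a = a" "a * oneA = a" "oneB * b = b" "b * oneB = b"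
  using identity_A identity_B by (auto simp: identity_element_def)

lemmas unital_simps [simp] = unital_M unital_N

lemmas action_diff =
  bilinear_map_diff[OF bimodule.lact_bilinear[OF bimodule_M]]
  bilinear_map_diff[OF bimodule.ract_bilinear[OF bimodule_M]]
  bilinear_map_diff[OF bimodule.lact_bilinear[OF bimodule_N]]
  bilinear_map_diff[OF bimodule.ract_bilinear[OF bimodule_N]]

text \<open>
  Commuting with the two kinds of off-diagonal matrices is the intertwining property, and commuting
  with \<open>e\<close> makes the matrix diagonal.  Intertwining suffices, because it makes
  \<open>[a, a']\<close> act by zero on both bimodules: \<open>(a a') m = (a' m) b = a' (m b) = (a' a) m\<close>, and likewise on
  the other side.
\<close>

lemma center_iff:
  "(a, m0, n0, b) \<in> alg_center mulU \<longleftrightarrow>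
     m0 = 0 \<and> n0 = 0 \<and> (\<forall>m. am a m = mb m b) \<and> (\<forall>n. na n a = bn b n)"
  (is "?L \<longleftrightarrow> ?R")
proof
  assume ?L
  then have comm: "mulU (a, m0, n0, b) x = mulU x (a, m0, n0, b)" for x
    by (rule alg_center_commute)
  have "m0 = 0" "n0 = 0"
    using comm[of eU] by (auto simp: gma_mult_def gma_bilinear)
  moreover have "am a m = mb m b" "na n a = bn b n" for m n
    using comm[of "(0, m, n, 0)"] by (auto simp: gma_mult_def gma_bilinear)
  ultimately show ?R by blast
next
  assume R: ?R
  then have intertwine: "am a m = mb m b" "na n a = bn b n" for m n by auto
  have "a * a' = a' * a" for a'
  proof -
    have "a * a' - a' * a = 0"
    proof (rule faithful_A)
      show "am (a * a' - a' * a) m = 0" for m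
        by (simp add: action_diff gma_assoc intertwine)
      show "na n (a * a' - a' * a) = 0" for n
        by (simp add: action_diff gma_assoc intertwine)
    qed
    then show ?thesis by simp
  qed
  moreover have "b * b' = b' * b" for b'
  proof -
    have "b * b' - b' * b = 0"
    proof (rule faithful_B)
      show "mb m (b * b' - b' * b) = 0" for m
        by (simp add: action_diff gma_assoc flip: intertwine)
      show "bn (b * b' - b' * b) n = 0" for n
        by (simp add: action_diff gma_assoc flip: intertwine)
    qed
    then show ?thesis by simp
  qed
  moreover have "a * mn m n = mn m n * a" for m n
    by (simp flip: gma_assoc(8,9) add: intertwine gma_assoc(7))
  moreover have "b * nm n m = nm n m * b" for m n
    by (simp flip: gma_assoc(11,12) intertwine add: gma_assoc(10))
  ultimately show ?L
    using R intertwine by (auto simp: alg_center_def gma_mult_def gma_bilinear)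
qed

lemma center_proj_A:
  assumes "a \<in> proj_A ` alg_center mulU"
  obtains b where "\<And>m. am a m = mb m b" "\<And>n. na n a = bn b n"
  using assms by (auto simp: proj_A_def center_iff)

lemma center_proj_B:
  assumes "b \<in> proj_B ` alg_center mulU"
  obtains a where "\<And>m. am a m = mb m b" "\<And>n. na n a = bn b n"
proof -
  obtain a m0 n0 where "(a, m0, n0, b) \<in> alg_center mulU"
    using assms by (auto simp: proj_B_def)
  then show ?thesis
    using that unfolding center_iff by blast
qed

section \<open>Lie triple centralizers on off-diagonal matrices\<close>

text \<open>
  The inner commutator has the entry \<open>a m - m b\<close> in \<open>M\<close> and \<open>b n - n a\<close> in \<open>N\<close>.  The commutator
  with \<open>f\<close> kills its diagonal, keeps the \<open>M\<close> entry and changes the sign of the \<open>N\<close> entry.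
\<close>

lemma bracket_offdiag_f:
  "brU (brU (a, m0, n0, b) (0, m, n, 0)) fU = (0, am a m - mb m b, na n a - bn b n, 0)"
  by (simp add: commutator_def gma_mult_def gma_bilinear)

lemma bracket_e_f: "brU (brU (a, m0, n0, b) eU) fU = (0, - m0, - n0, 0)"
  by (simp add: commutator_def gma_mult_def gma_bilinear)

lemma centralizer_offdiag_e:
  assumes "lie_triple_centralizer sU mulU \<phi>" and "\<phi> eU = (P, p, q, Q)"
  shows "\<phi> (0, m, n, 0) = (0, am P m - mb m Q, na n P - bn Q n, 0)"
  using lie_triple_centralizer_commutator[OF assms(1), of eU "(0, m, n, 0)" fU]
  by (simp add: assms(2) bracket_offdiag_f gma_bilinear)

lemma centralizer_offdiag_f:
  assumes \<phi>: "lie_triple_centralizer sU mulU \<phi>" and f: "\<phi> fU = (R, r, t, S)"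
  shows "\<phi> (0, m, n, 0) = (0, mb m S - am R m, bn S n - na n R, 0)"
proof -
  have "\<phi> (- (0, m, n, 0)) = - \<phi> (0, m, n, 0)"
    by (rule lie_triple_centralizer_uminus[OF \<phi>])
  moreover have "\<phi> (- (0, m, n, 0)) = (0, am R m - mb m S, na n R - bn S n, 0)"
    using lie_triple_centralizer_commutator[OF \<phi>, of fU "(0, m, n, 0)" fU]
    by (simp add: f bracket_offdiag_f gma_bilinear)
  ultimately have "\<phi> (0, m, n, 0) = - (0, am R m - mb m S, na n R - bn S n, 0)"
    by (metis minus_minus)
  then show ?thesis by simp
qed

lemma centralizer_offdiag_zero_central:
  assumes \<chi>: "lie_triple_centralizer sU mulU \<chi>"
    and zero: "\<And>m n. \<chi> (0, m, n, 0) = 0"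
  shows "\<chi> x \<in> alg_center mulU"
proof -
  obtain a m0 n0 b where x: "x = (a, m0, n0, b)" by (cases x)
  obtain a' m' n' b' where \<chi>x: "\<chi> x = (a', m', n', b')" by (cases "\<chi> x")
  have "brU (brU (\<chi> x) eU) fU = \<chi> (brU (brU x eU) fU)"
    by (simp add: lie_triple_centralizer_commutator[OF \<chi>])
  also have "\<dots> = 0" by (simp add: x bracket_e_f zero)
  finally have "m' = 0" "n' = 0" by (simp_all add: \<chi>x bracket_e_f zero_prod_def)
  moreover have "am a' m = mb m b' \<and> na n a' = bn b' n" for m n
  proof -
    have "brU (brU (\<chi> x) (0, m, n, 0)) fU = \<chi> (brU (brU x (0, m, n, 0)) fU)"
      by (simp add: lie_triple_centralizer_commutator[OF \<chi>])
    also have "\<dots> = 0" by (simp add: x bracket_offdiag_f zero)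
    finally show ?thesis by (simp add: \<chi>x bracket_offdiag_f zero_prod_def)
  qed
  ultimately show ?thesis by (simp add: \<chi>x center_iff)
qed

section \<open>Properness and the diagonal entries\<close>

theorem proper_if_central_at_identities:
  assumes \<phi>: "lie_triple_centralizer sU mulU \<phi>"
    and Q_central: "proj_B (\<phi> eU) \<in> proj_B ` alg_center mulU"
    and R_central: "proj_A (\<phi> fU) \<in> proj_A ` alg_center mulU"
  shows "proper_lie_triple_centralizer sU mulU \<phi>"
proof -
  obtain P p q Q where e: "\<phi> eU = (P, p, q, Q)" by (cases "\<phi> eU")
  obtain R r t S where f: "\<phi> fU = (R, r, t, S)" by (cases "\<phi> fU")
  obtain a0 where a0: "\<And>m. am a0 m = mb m Q" "\<And>n. na n a0 = bn Q n"
    using center_proj_B[OF Q_central] by (auto simp: e proj_B_def)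
  obtain b0 where b0: "\<And>m. am R m = mb m b0" "\<And>n. na n R = bn b0 n"
    using center_proj_A[OF R_central] by (auto simp: f proj_A_def)
  have via_A: "\<phi> (0, m, n, 0) = (0, am (P - a0) m, na n (P - a0), 0)" for m n
    by (simp add: centralizer_offdiag_e[OF \<phi> e] a0[symmetric] action_diff)
  have via_B: "\<phi> (0, m, n, 0) = (0, mb m (S - b0), bn (S - b0) n, 0)" for m n
    by (simp add: centralizer_offdiag_f[OF \<phi> f] b0 action_diff)
  define l :: "('a, 'm, 'n, 'b) gmat" where "l = (P - a0, 0, 0, S - b0)"
  have "am (P - a0) m = mb m (S - b0)" "na n (P - a0) = bn (S - b0) n" for m n
    using via_A[of m n] via_B[of m n] by simp_all
  then have l: "l \<in> alg_center mulU"
    by (simp add: l_def center_iff)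
  have "\<phi> (0, m, n, 0) - mulU l (0, m, n, 0) = 0" for m n
  proof -
    \<comment> \<open>The \<open>M\<close> entry is read off on the \<open>A\<close> side and the \<open>N\<close> entry on the \<open>B\<close> side.\<close>
    have "mulU l (0, m, n, 0) = (0, am (P - a0) m, bn (S - b0) n, 0)"
      by (simp add: l_def gma_mult_def gma_bilinear)
    then show ?thesis using via_A[of m n] via_B[of m n] by (simp add: zero_prod_def)
  qed
  then have "\<phi> x - mulU l x \<in> alg_center mulU" for x
    using lie_triple_centralizer_diff_central_mult[OF gma_assoc_algebra l \<phi>]
    by (rule centralizer_offdiag_zero_central[rotated])
  then show ?thesis
    by (rule proper_lie_triple_centralizerI[OF gma_assoc_algebra l \<phi>])
qed

theorem central_entries_if_proper:
  assumes "proper_lie_triple_centralizer sU mulU \<phi>"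
  shows "proj_B (\<phi> (a, 0, 0, 0)) \<in> proj_B ` alg_center mulU"
    and "proj_A (\<phi> (0, 0, 0, b)) \<in> proj_A ` alg_center mulU"
proof -
  obtain l \<chi> where l: "l \<in> alg_center mulU" and \<chi>: "\<And>x. \<chi> x \<in> alg_center mulU"
    and \<phi>: "\<And>x. \<phi> x = mulU l x + \<chi> x"
    using assms by (elim proper_lie_triple_centralizerE) blast
  obtain la lb where l_diag: "l = (la, 0, 0, lb)"
    using l by (cases l) (simp add: center_iff)
  have "proj_B (\<phi> (a, 0, 0, 0)) = proj_B (\<chi> (a, 0, 0, 0))"
    by (cases "\<chi> (a, 0, 0, 0)") (simp add: \<phi> l_diag gma_mult_def gma_bilinear proj_B_def)
  then show "proj_B (\<phi> (a, 0, 0, 0)) \<in> proj_B ` alg_center mulU"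
    using \<chi> by simp
  have "proj_A (\<phi> (0, 0, 0, b)) = proj_A (\<chi> (0, 0, 0, b))"
    by (cases "\<chi> (0, 0, 0, b)") (simp add: \<phi> l_diag gma_mult_def gma_bilinear proj_A_def)
  then show "proj_A (\<phi> (0, 0, 0, b)) \<in> proj_A ` alg_center mulU"
    using \<chi> by simp
qed

end

theorem theorem3p3:
  fixes sA :: "'r::comm_ring_1 \<Rightarrow> 'a::ring \<Rightarrow> 'a"
    and sB :: "'r \<Rightarrow> 'b::ring \<Rightarrow> 'b"
    and sM :: "'r \<Rightarrow> 'm::ab_group_add \<Rightarrow> 'm"
    and sN :: "'r \<Rightarrow> 'n::ab_group_add \<Rightarrow> 'n"
    and am :: "'a \<Rightarrow> 'm \<Rightarrow> 'm" and mb :: "'m \<Rightarrow> 'b \<Rightarrow> 'm"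
    and bn :: "'b \<Rightarrow> 'n \<Rightarrow> 'n" and na :: "'n \<Rightarrow> 'a \<Rightarrow> 'n"
    and mn :: "'m \<Rightarrow> 'n \<Rightarrow> 'a" and nm :: "'n \<Rightarrow> 'm \<Rightarrow> 'b"
    and oneA :: 'a and oneB :: 'b
    and \<phi> :: "('a, 'm, 'n, 'b) gmat \<Rightarrow> ('a, 'm, 'n, 'b) gmat"
    and \<alpha>\<^sub>4 :: "'a \<Rightarrow> 'b" and \<beta>\<^sub>1 :: "'b \<Rightarrow> 'a"
  defines "sU \<equiv> gma_scale sA sB sM sN"
    and "mulU \<equiv> gma_mult am mb bn na mn nm"
  assumes "unital_morita_context sA sB sM sN am mb bn na mn nm oneA oneB"
    and "\<And>a. (\<forall>m. am a m = 0) \<Longrightarrow> (\<forall>n. na n a = 0) \<Longrightarrow> a = 0"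
    and "\<And>b. (\<forall>m. mb m b = 0) \<Longrightarrow> (\<forall>n. bn b n = 0) \<Longrightarrow> b = 0"
    and "lie_triple_centralizer sU mulU \<phi>"
    and "\<And>a. \<alpha>\<^sub>4 a = proj_B (\<phi> (a, 0, 0, 0))"
    and "\<And>b. \<beta>\<^sub>1 b = proj_A (\<phi> (0, 0, 0, b))"
  shows "(proper_lie_triple_centralizer sU mulU \<phi> \<longleftrightarrow>
            range \<alpha>\<^sub>4 \<subseteq> proj_B ` alg_center mulU \<and> range \<beta>\<^sub>1 \<subseteq> proj_A ` alg_center mulU) \<and>
         (range \<alpha>\<^sub>4 \<subseteq> proj_B ` alg_center mulU \<and> range \<beta>\<^sub>1 \<subseteq> proj_A ` alg_center mulU \<longleftrightarrow>
            \<alpha>\<^sub>4 oneA \<in> proj_B ` alg_center mulU \<and> \<beta>\<^sub>1 oneB \<in> proj_A ` alg_center mulU)"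
proof -
  interpret faithful_morita_context sA sB sM sN am mb bn na mn nm oneA oneB
  proof (rule faithful_morita_context.intro[OF assms(3)], rule faithful_morita_context_axioms.intro)
    show "a = 0" if "\<And>m. am a m = 0" "\<And>n. na n a = 0" for a
      by (rule assms(4)) (rule allI, rule that)+
    show "b = 0" if "\<And>m. mb m b = 0" "\<And>n. bn b n = 0" for b
      by (rule assms(5)) (rule allI, rule that)+
  qed
  have "proper_lie_triple_centralizer sU mulU \<phi>"
    if "\<alpha>\<^sub>4 oneA \<in> proj_B ` alg_center mulU" "\<beta>\<^sub>1 oneB \<in> proj_A ` alg_center mulU"
    using proper_if_central_at_identities that assms(6-8) unfolding sU_def mulU_def by simp
  moreover have "range \<alpha>\<^sub>4 \<subseteq> proj_B ` alg_center mulU \<and> range \<beta>\<^sub>1 \<subseteq> proj_A ` alg_center mulU"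
    if "proper_lie_triple_centralizer sU mulU \<phi>"
    using central_entries_if_proper that assms(7,8) unfolding sU_def mulU_def by auto
  ultimately show ?thesis by blast
qed

end
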